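(* Let $d>1$ be an integer, let $\beta\in\mathbb{C}$, let $\omega=e^{2\pi i/d}$, and let $\mathcal{E}_k=\{k+dj : j\in\mathbb{N}_0\}$ for $0\le k\le d-1$. Put $\lambda_k=-\beta\omega^{-k+1}$ for $0\le k\le d-1$. Assume that the Fock space version of the HRT conjecture holds for the points $\lambda_0,\dots,\lambda_{d-1}$, that is: if $\lambda_0,\dots,\lambda_{d-1}$ are pairwise distinct, then for every $g\in F^2\setminus\{0\}$ the functions $U_{\lambda_0}g,\dots,U_{\lambda_{d-1}}g$ are linearly independent in $F^2$. Then every $f\in F^2$ satisfying $$f^{(j)}(0)=0\quad\text{for all } j\in\mathcal{E}_0,$$ and $$(U_{\beta}f)^{(j)}(0)=0\quad\text{for all } j\in\mathcal{E}_k\text{ and all }1\le k\le d-1,$$ is identically zero: $f=0$.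
   Context: $\mathbb{N}_0=\{0,1,2,\dots\}$. The Fock space $F^2$ is the complex Hilbert space of all entire functions $f$ on $\mathbb{C}$ with $\|f\|^2=\int_{\mathbb{C}}|f(z)|^2e^{-|z|^2}\,\mathrm{d}A(z)<\infty$, where $\mathrm{d}A(z)=\pi^{-1}\mathrm{d}x\,\mathrm{d}y$, $z=x+iy$. For $\alpha\in\mathbb{C}$, the Weyl operator $U_\alpha:F^2\to F^2$ is the unitary operator defined by $U_\alpha f(z)=e^{-\frac12|\alpha|^2-\overline{\alpha}z}f(z+\alpha)$. $f^{(j)}$ denotes the $j$-th complex derivative, with $f^{(0)}=f$. Linear independence is over $\mathbb{C}$. *)

theory Defs
  imports "HOL-Complex_Analysis.Complex_Analysis"
begin

definition area_measure :: "complex measure" where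
  "area_measure = scale_measure (ennreal (1 / pi)) lborel"

definition fock_norm_sq :: "(complex \<Rightarrow> complex) \<Rightarrow> ennreal" where
  "fock_norm_sq f = (\<integral>\<^sup>+ z. ennreal ((cmod (f z))\<^sup>2 * exp (- (cmod z)\<^sup>2)) \<partial>area_measure)"

definition fock_space :: "(complex \<Rightarrow> complex) set" where
  "fock_space = {f. f holomorphic_on UNIV \<and> fock_norm_sq f < \<infinity>}"

text \<open>The formula makes sense for every function; it is only applied to elements of
  \<^const>\<open>fock_space\<close>.\<close>

definition weyl :: "complex \<Rightarrow> (complex \<Rightarrow> complex) \<Rightarrow> complex \<Rightarrow> complex" where
  "weyl \<alpha> f = (\<lambda>z. exp (- complex_of_real ((cmod \<alpha>)\<^sup>2) / 2 - cnj \<alpha> * z) * f (z + \<alpha>))"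

text \<open>Linear independence over the complex numbers of a family (not of a set) of functions
  indexed by a finite set: in particular, a family with a repeated member is dependent. Elements
  of \<^const>\<open>fock_space\<close> are actual functions, so a vanishing linear combination vanishes
  pointwise.\<close>

definition lin_indep_family :: "'i set \<Rightarrow> ('i \<Rightarrow> complex \<Rightarrow> complex) \<Rightarrow> bool" where
  "lin_indep_family I v \<longleftrightarrow>
     (\<forall>c. (\<forall>z. (\<Sum>i\<in>I. c i * v i z) = 0) \<longrightarrow> (\<forall>i\<in>I. c i = 0))"

definition fock_HRT :: "nat \<Rightarrow> (nat \<Rightarrow> complex) \<Rightarrow> bool" where
  "fock_HRT n p \<longleftrightarrow>
     (inj_on p {..<n} \<longrightarrow>
       (\<forall>g\<in>fock_space. g \<noteq> (\<lambda>_. 0) \<longrightarrow> lin_indep_family {..<n} (\<lambda>k. weyl (p k) g)))"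

definition residue_class :: "nat \<Rightarrow> nat \<Rightarrow> nat set" where
  "residue_class d k = {k + d * j | j. True}"

end

theory Submission
  imports Defs
begin

text \<open>Put \<open>h = U\<^bsub>\<beta>\<^esub> f\<close>. The conditions on the derivatives of \<open>h\<close> say that \<open>h\<close> is invariant under
  rotation by \<open>\<omega>\<close>, and those on \<open>f\<close> that the average of \<open>f\<close> over these rotations vanishes.
  Since \<open>f = U\<^bsub>-\<beta>\<^esub> h\<close>, rotating \<open>f\<close> by \<open>\<omega>\<^sup>m\<close> amounts to applying the Weyl operator of
  the rotated point \<open>-\<beta>\<omega>\<^bsup>-m\<^esup>\<close> to \<open>h\<close>. So the average is a vanishing linear
  combination of the \<open>U\<^bsub>\<lambda>\<^esub> h\<close>, and the HRT hypothesis forces \<open>h = 0\<close>. If \<open>\<beta> = 0\<close>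
  the points coincide, but then \<open>h = f\<close> and all Taylor coefficients of \<open>f\<close> vanish.\<close>

lemma entire_taylor_sums:
  assumes "f holomorphic_on UNIV"
  shows "(\<lambda>n. (deriv ^^ n) f 0 / fact n * z ^ n) sums f z"
proof -
  have "f holomorphic_on ball 0 (cmod z + 1)"
    using assms by (rule holomorphic_on_subset) simp
  moreover have "z \<in> ball 0 (cmod z + 1)" by simp
  ultimately show ?thesis
    using holomorphic_power_series[of f 0 "cmod z + 1" z] by simp
qed

text \<open>Only the powers \<open>z ^ n\<close> with \<open>d dvd n\<close> survive in the Taylor
  series, and each of these is unchanged when \<open>z\<close> is multiplied by a d-th root of
  unity.\<close>

lemma entire_rotation_invariant:
  assumes hol: "f holomorphic_on UNIV" and root: "\<omega> ^ d = 1"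
    and coeff: "\<And>n. \<not> d dvd n \<Longrightarrow> (deriv ^^ n) f 0 = 0"
  shows "f (\<omega> * z) = f z"
proof -
  have eq: "(deriv ^^ n) f 0 / fact n * (\<omega> * z) ^ n = (deriv ^^ n) f 0 / fact n * z ^ n" for n
    by (cases "d dvd n") (auto simp: coeff power_mult power_mult_distrib root elim!: dvdE)
  show ?thesis
    using entire_taylor_sums[OF hol, of "\<omega> * z", unfolded eq] entire_taylor_sums[OF hol, of z]
    by (rule sums_unique2)
qed

text \<open>Summing over the rotations multiplies the n-th Taylor term by a geometric sum in
  \<open>\<omega> ^ n\<close>. This sum vanishes unless \<open>d dvd n\<close>, and there the
  coefficient itself is zero.\<close>

lemma entire_rotation_sum_eq_0:
  assumes hol: "f holomorphic_on UNIV"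
    and root: "\<And>n. \<omega> ^ n = 1 \<longleftrightarrow> d dvd n"
    and coeff: "\<And>n. d dvd n \<Longrightarrow> (deriv ^^ n) f 0 = 0"
  shows "(\<Sum>m<d. f (\<omega> ^ m * z)) = 0"
proof -
  have "(\<lambda>n. \<Sum>m<d. (deriv ^^ n) f 0 / fact n * (\<omega> ^ m * z) ^ n) sums (\<Sum>m<d. f (\<omega> ^ m * z))"
    by (intro sums_sum entire_taylor_sums hol)
  moreover have "(\<Sum>m<d. (deriv ^^ n) f 0 / fact n * (\<omega> ^ m * z) ^ n) = 0" for n
  proof (cases "d dvd n")
    case True
    then show ?thesis by (simp add: coeff)
  next
    case False
    have "(\<omega> ^ n) ^ d = 1"
      by (metis dvd_triv_right power_mult root)
    then have "(\<Sum>m<d. (\<omega> ^ n) ^ m) = 0"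
      using False root[of n] geometric_sum[of "\<omega> ^ n" d] by simp
    moreover have "(\<Sum>m<d. (deriv ^^ n) f 0 / fact n * (\<omega> ^ m * z) ^ n)
        = (deriv ^^ n) f 0 / fact n * z ^ n * (\<Sum>m<d. (\<omega> ^ n) ^ m)"
      unfolding sum_distrib_left
      by (rule sum.cong) (simp_all add: power_mult_distrib mult_ac flip: power_mult)
    ultimately show ?thesis by simp
  qed
  ultimately show ?thesis by (simp add: sums_iff)
qed

lemma primitive_root_power_eq_1_iff:
  assumes "d > 0" and "\<omega> = exp (2 * of_real pi * \<i> / of_nat d)"
  shows "\<omega> ^ n = 1 \<longleftrightarrow> d dvd n"
proof -
  have "\<omega> ^ n = exp (2 * of_real pi * \<i> * of_nat n / of_nat d)"
    by (simp add: assms exp_of_nat_mult[symmetric] algebra_simps)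
  then show ?thesis
    using complex_root_unity_eq_1[of d n] assms by simp
qed

lemma weyl_holomorphic:
  assumes "f holomorphic_on UNIV"
  shows "weyl \<alpha> f holomorphic_on UNIV"
proof -
  have "(f \<circ> (\<lambda>z. z + \<alpha>)) holomorphic_on UNIV"
    by (intro holomorphic_on_compose_gen[OF _ assms] holomorphic_intros) auto
  then show ?thesis
    unfolding weyl_def o_def by (intro holomorphic_intros)
qed

text \<open>Completing the square: the modulus of the exponential factor turns the Gaussian weight
  at \<open>z\<close> into the one at \<open>z + \<alpha>\<close>. Unitarity thus reduces to a
  translation of the integrand.\<close>

lemma weyl_density:
  "(cmod (weyl \<alpha> f z))\<^sup>2 * exp (- (cmod z)\<^sup>2)
     = (cmod (f (z + \<alpha>)))\<^sup>2 * exp (- (cmod (z + \<alpha>))\<^sup>2)"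
proof -
  define e where "e = - (cmod \<alpha>)\<^sup>2 / 2 - Re (cnj \<alpha> * z)"
  have "cmod (weyl \<alpha> f z) = exp e * cmod (f (z + \<alpha>))"
    by (simp add: weyl_def norm_mult e_def)
  moreover have "2 * e - (cmod z)\<^sup>2 = - (cmod (z + \<alpha>))\<^sup>2"
    unfolding e_def cmod_power2 by (simp add: power2_eq_square field_simps)
  then have "(exp e)\<^sup>2 * exp (- (cmod z)\<^sup>2) = exp (- (cmod (z + \<alpha>))\<^sup>2)"
    by (simp add: power2_eq_square mult_exp_exp)
  ultimately show ?thesis
    by (simp add: power_mult_distrib mult_ac)
qed

lemma weyl_fock_space:
  assumes "f \<in> fock_space"
  shows "weyl \<alpha> f \<in> fock_space"
proof -
  have hol: "f holomorphic_on UNIV" and fin: "fock_norm_sq f < \<infinity>"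
    using assms by (auto simp: fock_space_def)
  define F where "F z = ennreal ((cmod (f z))\<^sup>2 * exp (- (cmod z)\<^sup>2))" for z
  have [measurable]: "f \<in> borel_measurable borel"
    using hol by (intro borel_measurable_continuous_onI holomorphic_on_imp_continuous_on)
  have [measurable]: "F \<in> borel_measurable borel"
    unfolding F_def by measurable
  \<comment> \<open>Lebesgue measure is translation invariant, which removes the shift left by
    \<open>weyl_density\<close>.\<close>
  have "(\<integral>\<^sup>+ z. F z \<partial>lborel) = (\<integral>\<^sup>+ z. F z \<partial>distr lborel borel ((+) \<alpha>))"
    by (simp add: lborel_distr_plus)
  also have "\<dots> = (\<integral>\<^sup>+ z. F (\<alpha> + z) \<partial>lborel)"
    by (rule nn_integral_distr) auto
  finally have "fock_norm_sq (weyl \<alpha> f) = fock_norm_sq f"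
    by (simp add: fock_norm_sq_def area_measure_def nn_integral_scale_measure weyl_density
        F_def add.commute)
  then show ?thesis
    using weyl_holomorphic[OF hol] fin by (simp add: fock_space_def)
qed

text \<open>The two Gaussian constants contribute -|\<alpha>|^2 to the exponent, and evaluating the
  inner linear term at \<open>z - \<alpha>\<close> gives back +|\<alpha>|^2.\<close>

lemma weyl_uminus_weyl: "weyl (- \<alpha>) (weyl \<alpha> f) = f"
proof
  fix z
  have "exp (- complex_of_real ((cmod \<alpha>)\<^sup>2) / 2 + cnj \<alpha> * z) *
      exp (- complex_of_real ((cmod \<alpha>)\<^sup>2) / 2 - cnj \<alpha> * (z - \<alpha>)) = 1"
    by (simp add: mult_exp_exp algebra_simps complex_norm_square[unfolded of_real_power])
  then show "weyl (- \<alpha>) (weyl \<alpha> f) z = f z"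
    by (simp add: weyl_def mult.assoc[symmetric])
qed

text \<open>For unimodular \<open>u\<close>, the argument \<open>u * z + \<alpha>\<close> factors as
  \<open>u * (z + cnj u * \<alpha>)\<close>, and the invariance of \<open>h\<close> discards the
  outer \<open>u\<close>. The exponential already agrees, since \<open>cnj \<alpha> * u\<close> is
  the conjugate of \<open>cnj u * \<alpha>\<close>.\<close>

lemma weyl_rotate:
  assumes "cmod u = 1" and "\<And>w. h (u * w) = h w"
  shows "weyl \<alpha> h (u * z) = weyl (cnj u * \<alpha>) h z"
proof -
  have "u * cnj u = 1"
    using assms(1) by (simp add: complex_norm_square[symmetric])
  then have "u * z + \<alpha> = u * (z + cnj u * \<alpha>)"
    by (metis distrib_left mult.assoc mult_1)
  then have "h (u * z + \<alpha>) = h (z + cnj u * \<alpha>)"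
    by (simp only: assms(2))
  then show ?thesis
    using assms(1) by (simp add: weyl_def norm_mult mult_ac)
qed

theorem theorem7:
  fixes d :: nat and \<beta> \<omega> :: complex and p :: "nat \<Rightarrow> complex" and f :: "complex \<Rightarrow> complex"
  assumes "d > 1"
    and "\<omega> = exp (2 * of_real pi * \<i> / of_nat d)"
    and "\<And>k. k < d \<Longrightarrow> p k = - \<beta> * \<omega> powi (- int k + 1)"
    and "fock_HRT d p"
    and "f \<in> fock_space"
    and "\<And>j. j \<in> residue_class d 0 \<Longrightarrow> (deriv ^^ j) f 0 = 0"
    and "\<And>k j. 1 \<le> k \<Longrightarrow> k \<le> d - 1 \<Longrightarrow> j \<in> residue_class d k \<Longrightarrow>
           (deriv ^^ j) (weyl \<beta> f) 0 = 0"
  shows "f = (\<lambda>_. 0)"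
proof -
  define h where "h = weyl \<beta> f"
  have hol_f: "f holomorphic_on UNIV"
    using assms(5) by (simp add: fock_space_def)
  have hol_h: "h holomorphic_on UNIV"
    unfolding h_def by (rule weyl_holomorphic[OF hol_f])
  have coeff_f: "(deriv ^^ n) f 0 = 0" if "d dvd n" for n
    using that by (intro assms(6)) (auto simp: residue_class_def elim: dvdE)
  \<comment> \<open>A non-multiple of \<open>d\<close> lies in the class of its nonzero remainder,
    so \<open>k\<close> is taken to be \<open>n mod d\<close>.\<close>
  have coeff_h: "(deriv ^^ n) h 0 = 0" if "\<not> d dvd n" for n
    unfolding h_def
  proof (rule assms(7))
    show "1 \<le> n mod d" using that by (simp add: dvd_eq_mod_eq_0 Suc_le_eq)
    show "n mod d \<le> d - 1" using assms(1) by (simp add: less_Suc_eq_le[symmetric])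
    show "n \<in> residue_class d (n mod d)"
      unfolding residue_class_def by (metis (mono_tags, lifting) mem_Collect_eq mod_mult_div_eq)
  qed
  have root: "\<omega> ^ n = 1 \<longleftrightarrow> d dvd n" for n
    using primitive_root_power_eq_1_iff assms(1,2) by simp
  have norm_\<omega>: "cmod \<omega> = 1"
    by (simp add: assms(2))
  then have "\<omega> \<noteq> 0" by auto
  have inv_h: "h (\<omega> ^ m * z) = h z" for m z
  proof -
    have "(\<omega> ^ m) ^ d = 1"
      by (metis dvd_triv_right power_mult root)
    then show ?thesis
      by (rule entire_rotation_invariant[OF hol_h _ coeff_h])
  qed
  have p_eq: "p m = cnj (\<omega> ^ m) * (- \<beta> * \<omega>)" if "m < d" for m
  proof -
    have "\<omega> ^ m * cnj (\<omega> ^ m) = 1"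
      using norm_\<omega> by (simp add: norm_power del: complex_cnj_power flip: complex_norm_square)
    then have "inverse (\<omega> ^ m) = cnj (\<omega> ^ m)"
      by (rule inverse_unique)
    moreover have "\<omega> powi (- int m + 1) = inverse (\<omega> ^ m) * \<omega>"
      using \<open>\<omega> \<noteq> 0\<close> power_int_add[of \<omega> "- int m" 1] by (simp add: power_int_minus)
    ultimately show ?thesis
      using assms(3)[OF that] by simp
  qed
  have dep: "(\<Sum>m<d. weyl (p m) h z) = 0" for z
  proof -
    \<comment> \<open>The factor \<open>cnj \<omega>\<close> accounts for the +1 in the exponent
      defining \<open>p\<close>: the rotation needed is by \<omega>^(m-1), which this form expresses
      for m = 0 as well.\<close>
    have "weyl (p m) h z = f (\<omega> ^ m * (cnj \<omega> * z))" if "m < d" for m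
    proof -
      define u where "u = \<omega> ^ m * cnj \<omega>"
      have "cnj \<omega> * \<omega> = 1"
        using norm_\<omega> by (metis complex_norm_square mult.commute of_real_1 power_one)
      then have "\<omega> * (u * w) = \<omega> ^ m * w" for w
        unfolding u_def by (metis mult.assoc mult.commute mult_1)
      \<comment> \<open>Both \<open>h (u * w)\<close> and \<open>h w\<close> equal
        \<open>h (\<omega> ^ m * w)\<close>, the former by one further rotation by
        \<open>\<omega>\<close>.\<close>
      then have inv_u: "h (u * w) = h w" for w
        by (metis inv_h power_one_right)
      have "f (u * z) = weyl (- \<beta>) h (u * z)"
        by (simp add: h_def weyl_uminus_weyl)
      also have "\<dots> = weyl (cnj u * - \<beta>) h z"
        by (rule weyl_rotate) (use inv_u norm_\<omega> in \<open>simp_all add: u_def norm_mult norm_power\<close>)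
      also have "cnj u * - \<beta> = p m"
        using p_eq[OF that] by (simp add: u_def mult_ac)
      finally show ?thesis by (simp add: u_def mult.assoc)
    qed
    then show ?thesis
      using entire_rotation_sum_eq_0[OF hol_f root coeff_f, of "cnj \<omega> * z"] by simp
  qed
  show ?thesis
  proof (cases "\<beta> = 0")
    case True
    then have "h = f" by (simp add: h_def weyl_def)
    then have "(deriv ^^ n) f 0 = 0" for n
      using coeff_f coeff_h by metis
    then show ?thesis
      using entire_taylor_sums[OF hol_f] by (auto simp: fun_eq_iff sums_iff)
  next
    case False
    have "inj_on p {..<d}"
    proof (rule inj_onI)
      fix k l assume kl: "k \<in> {..<d}" "l \<in> {..<d}" "p k = p l"
      \<comment> \<open>Cancel the nonzero factor \<open>- \<beta> * \<omega>\<close> in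
        \<open>p_eq\<close> and conjugate.\<close>
      then have "\<omega> ^ k = \<omega> ^ l"
        using p_eq False \<open>\<omega> \<noteq> 0\<close> by (simp flip: complex_cnj_power)
      then have "exp (2 * of_real pi * \<i> * of_nat k / of_nat d)
          = exp (2 * of_real pi * \<i> * of_nat l / of_nat d)"
        by (simp add: assms(2) exp_of_nat_mult[symmetric] algebra_simps)
      then show "k = l"
        using complex_root_unity_eq[of d k l] assms(1) kl by (simp add: cong_def)
    qed
    then have indep: "g \<in> fock_space \<Longrightarrow> g \<noteq> (\<lambda>_. 0) \<Longrightarrow>
        lin_indep_family {..<d} (\<lambda>k. weyl (p k) g)" for g
      using assms(4) by (simp add: fock_HRT_def)
    \<comment> \<open>By \<open>dep\<close>, the coefficients all equal to 1 give a vanishing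
      combination; index 0 witnesses that they are not all zero.\<close>
    have "\<not> lin_indep_family {..<d} (\<lambda>k. weyl (p k) h)"
      unfolding lin_indep_family_def not_all not_imp
      by (rule exI[of _ "\<lambda>_. 1"]) (use dep assms(1) in \<open>auto intro!: bexI[of _ 0]\<close>)
    then have "h = (\<lambda>_. 0)"
      using indep weyl_fock_space[OF assms(5)] unfolding h_def by blast
    then have "f = weyl (- \<beta>) (\<lambda>_. 0)"
      by (metis h_def weyl_uminus_weyl)
    then show ?thesis by (simp add: weyl_def)
  qed
qed

end
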